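(* Let $a,b\in\mathbb{R}_+$ with $a\ne b$. As functions of $(p,q)$, the Stolarsky means $S_{p,q}(a,b)$, the Gini means $G_{p,q}(a,b)$, the two-parameter identric (exponential) means $I_{p,q}(a,b)$ and the two-parameter Heronian means $He_{p,q}(a,b)$ are all strictly bivariate log-concave on $[0,\infty)\times[0,\infty)$ and strictly bivariate log-convex on $(-\infty,0]\times(-\infty,0]$.
   Context: Notation: $\mathbb{R}_+=(0,\infty)$. For $x,y>0$, $G(x,y)=\sqrt{xy}$; for $x\neq y$, $L(x,y)=\frac{x-y}{\ln x-\ln y}$ and $I(x,y)=e^{-1}(x^x/y^y)^{1/(x-y)}$, with $L(x,x)=I(x,x)=x$; and $Y=I\,e^{1-G^2/L^2}$. For $a,b\in\mathbb{R}_+$, $a\neq b$: Stolarsky means: $S_{p,q}(a,b)=\left(\frac{q(a^p-b^p)}{p(a^q-b^q)}\right)^{1/(p-q)}$ if $pq(p-q)\ne0$; $S_{p,0}(a,b)=S_{0,p}(a,b)=\left(\frac{a^p-b^p}{p(\ln a-\ln b)}\right)^{1/p}$ if $p\neq0$; $S_{p,p}(a,b)=\exp\left(\frac{a^p\ln a-b^p\ln b}{a^p-b^p}-\frac1p\right)$ if $p\neq0$; $S_{0,0}(a,b)=\sqrt{ab}$. Gini means: $G_{p,q}(a,b)=\left(\frac{a^p+b^p}{a^q+b^q}\right)^{1/(p-q)}$ if $p\ne q$; $G_{p,p}(a,b)=\exp\left(\frac{a^p\ln a+b^p\ln b}{a^p+b^p}\right)$. Two-parameter identric means: $I_{p,q}(a,b)=\left(\frac{I(a^p,b^p)}{I(a^q,b^q)}\right)^{1/(p-q)}$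 if $p\neq q$; $I_{p,p}(a,b)=Y^{1/p}(a^p,b^p)=\left(Y(a^p,b^p)\right)^{1/p}$ if $p\neq0$; $I_{0,0}(a,b)=\sqrt{ab}$ (the limit value). Two-parameter Heronian means: $He_{p,q}(a,b)=\left(\frac{a^p+(\sqrt{ab})^p+b^p}{a^q+(\sqrt{ab})^q+b^q}\right)^{1/(p-q)}$ if $p\neq q$; $He_{p,p}(a,b)=\lim_{q\to p}He_{p,q}(a,b)=a^{\frac{a^p+(\sqrt{ab})^p/2}{a^p+(\sqrt{ab})^p+b^p}}\,b^{\frac{(\sqrt{ab})^p/2+b^p}{a^p+(\sqrt{ab})^p+b^p}}$. A positive function $\Psi$ on a convex set $\Omega\subseteq\mathbb{R}^2$ is strictly bivariate log-convex (log-concave) if $\ln\Psi$ is strictly convex (strictly concave) as a function of two variables on $\Omega$. *)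

theory Defs
  imports "HOL-Analysis.Analysis"
begin

definition strictly_convex_on :: "'a::real_vector set \<Rightarrow> ('a \<Rightarrow> real) \<Rightarrow> bool" where
  "strictly_convex_on S f \<longleftrightarrow> convex S \<and>
     (\<forall>x\<in>S. \<forall>y\<in>S. x \<noteq> y \<longrightarrow> (\<forall>u>0. \<forall>v>0. u + v = 1 \<longrightarrow>
        f (u *\<^sub>R x + v *\<^sub>R y) < u * f x + v * f y))"

definition strictly_concave_on :: "'a::real_vector set \<Rightarrow> ('a \<Rightarrow> real) \<Rightarrow> bool" where
  "strictly_concave_on S f \<longleftrightarrow> strictly_convex_on S (\<lambda>x. - f x)"

text \<open>
  ``Strictly bivariate'' means strict convexity jointly in both variables, so a function
  of two parameters is taken as a function on \<^typ>\<open>real \<times> real\<close>. Positivity is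
  part of the notion, since \<^term>\<open>ln\<close> is total.
\<close>

definition strictly_bivariate_log_convex_on :: "(real \<times> real) set \<Rightarrow> (real \<times> real \<Rightarrow> real) \<Rightarrow> bool" where
  "strictly_bivariate_log_convex_on S f \<longleftrightarrow>
     (\<forall>x\<in>S. 0 < f x) \<and> strictly_convex_on S (\<lambda>x. ln (f x))"

definition strictly_bivariate_log_concave_on :: "(real \<times> real) set \<Rightarrow> (real \<times> real \<Rightarrow> real) \<Rightarrow> bool" where
  "strictly_bivariate_log_concave_on S f \<longleftrightarrow>
     (\<forall>x\<in>S. 0 < f x) \<and> strictly_concave_on S (\<lambda>x. ln (f x))"

definition geometric_mean :: "real \<Rightarrow> real \<Rightarrow> real" where
  "geometric_mean x y = sqrt (x * y)"

definition logarithmic_mean :: "real \<Rightarrow> real \<Rightarrow> real" where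
  "logarithmic_mean x y = (if x = y then x else (x - y) / (ln x - ln y))"

definition identric_mean :: "real \<Rightarrow> real \<Rightarrow> real" where
  "identric_mean x y =
     (if x = y then x else exp (-1) * ((x powr x) / (y powr y)) powr (1 / (x - y)))"

definition Y_mean :: "real \<Rightarrow> real \<Rightarrow> real" where
  "Y_mean x y =
     identric_mean x y * exp (1 - (geometric_mean x y)\<^sup>2 / (logarithmic_mean x y)\<^sup>2)"

definition stolarsky_mean :: "real \<Rightarrow> real \<Rightarrow> real \<Rightarrow> real \<Rightarrow> real" where
  "stolarsky_mean p q a b =
     (if p = 0 \<and> q = 0 then sqrt (a * b)
      else if q = 0 then ((a powr p - b powr p) / (p * (ln a - ln b))) powr (1 / p)
      else if p = 0 then ((a powr q - b powr q) / (q * (ln a - ln b))) powr (1 / q)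
      else if p = q then
        exp ((a powr p * ln a - b powr p * ln b) / (a powr p - b powr p) - 1 / p)
      else ((q * (a powr p - b powr p)) / (p * (a powr q - b powr q))) powr (1 / (p - q)))"

definition gini_mean :: "real \<Rightarrow> real \<Rightarrow> real \<Rightarrow> real \<Rightarrow> real" where
  "gini_mean p q a b =
     (if p \<noteq> q then ((a powr p + b powr p) / (a powr q + b powr q)) powr (1 / (p - q))
      else exp ((a powr p * ln a + b powr p * ln b) / (a powr p + b powr p)))"

definition identric_mean2 :: "real \<Rightarrow> real \<Rightarrow> real \<Rightarrow> real \<Rightarrow> real" where
  "identric_mean2 p q a b =
     (if p \<noteq> q then
        (identric_mean (a powr p) (b powr p) / identric_mean (a powr q) (b powr q)) powr (1 / (p - q))
      else if p \<noteq> 0 then Y_mean (a powr p) (b powr p) powr (1 / p)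
      else sqrt (a * b))"

definition heronian_mean2 :: "real \<Rightarrow> real \<Rightarrow> real \<Rightarrow> real \<Rightarrow> real" where
  "heronian_mean2 p q a b =
     (if p \<noteq> q then
        ((a powr p + sqrt (a * b) powr p + b powr p) /
         (a powr q + sqrt (a * b) powr q + b powr q)) powr (1 / (p - q))
      else
        a powr ((a powr p + sqrt (a * b) powr p / 2) / (a powr p + sqrt (a * b) powr p + b powr p)) *
        b powr ((sqrt (a * b) powr p / 2 + b powr p) / (a powr p + sqrt (a * b) powr p + b powr p)))"

lemma heronian_mean2_diagonal:
  assumes "0 < a" and "0 < b"
  shows "((\<lambda>q. heronian_mean2 p q a b) \<longlongrightarrow> heronian_mean2 p p a b) (at p)"
proof -
  define s where "s = sqrt (a * b)"
  define N where "N = (\<lambda>t. a powr t + s powr t + b powr t)"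
  define D where "D = (a powr p * ln a + s powr p * ln s + b powr p * ln b) / N p"
  have s: "0 < s" and ln_s: "ln s = (ln a + ln b) / 2"
    using assms by (auto simp: s_def ln_sqrt ln_mult)
  have N: "0 < N t" for t
    using assms s by (simp add: N_def add_pos_pos)
  have "((\<lambda>t. ln (N t)) has_real_derivative D) (at p)"
    unfolding N_def D_def using assms s N[of p]
    by (auto intro!: derivative_eq_intros simp: N_def field_simps)
  then have "((\<lambda>q. (ln (N q) - ln (N p)) / (q - p)) \<longlongrightarrow> D) (at p)"
    by (simp add: has_field_derivative_iff)
  then have "((\<lambda>q. exp ((ln (N q) - ln (N p)) / (q - p))) \<longlongrightarrow> exp D) (at p)"
    by (rule tendsto_exp)
  moreover have "exp ((ln (N q) - ln (N p)) / (q - p)) = heronian_mean2 p q a b" if "q \<noteq> p" for q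
  proof -
    have "heronian_mean2 p q a b = (N p / N q) powr (1 / (p - q))"
      using that by (simp add: heronian_mean2_def N_def s_def)
    also have "\<dots> = exp ((ln (N p) - ln (N q)) / (p - q))"
      using N[of p] N[of q] by (simp add: powr_def ln_div)
    also have "(ln (N p) - ln (N q)) / (p - q) = (ln (N q) - ln (N p)) / (q - p)"
      using that by (simp add: field_simps)
    finally show ?thesis by simp
  qed
  then have "\<forall>\<^sub>F q in at p. exp ((ln (N q) - ln (N p)) / (q - p)) = heronian_mean2 p q a b"
    by (auto simp: eventually_at_filter)
  moreover have "heronian_mean2 p p a b = exp D"
  proof -
    have "heronian_mean2 p p a b =
        exp ((a powr p + s powr p / 2) / N p * ln a + (s powr p / 2 + b powr p) / N p * ln b)"
      using assms by (simp add: heronian_mean2_def powr_def N_def s_def exp_add)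
    also have "(a powr p + s powr p / 2) / N p * ln a + (s powr p / 2 + b powr p) / N p * ln b = D"
      using N[of p] by (simp add: D_def ln_s field_simps)
    finally show ?thesis .
  qed
  ultimately show ?thesis
    using Lim_transform_eventually by fastforce
qed

end

theory Submission
  imports Defs "HOL-Real_Asymp.Real_Asymp"
begin

text \<open>
  Write \<open>a = exp (m + c)\<close> and \<open>b = exp (m - c)\<close>. Each of the four means satisfies
  \<open>ln M(p, q) = m + c * F[c p, c q]\<close>, where \<open>F[x, y]\<close> is the divided difference of an even
  function \<open>F\<close>: \<open>ln (sinh x / x)\<close> for Stolarsky, \<open>ln (cosh x)\<close> for Gini, \<open>x coth x - 1\<close> for
  the identric and \<open>ln (1 + 2 cosh x)\<close> for the Heronian means. A divided difference averages the
  derivative over a segment, so it is jointly strictly concave on the quadrant of nonnegative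
  arguments as soon as the derivative of \<open>F\<close> is strictly concave there, which is read off the sign
  of the third derivative. As the derivative of \<open>F\<close> is odd, the reflection
  \<open>(p, q) \<mapsto> (-p, -q)\<close> turns this into convexity on the opposite quadrant.
\<close>

section \<open>Strict concavity on the half-line of nonnegative reals\<close>

lemma strictly_concave_onD:
  assumes "strictly_concave_on S f" "x \<in> S" "y \<in> S" "x \<noteq> y" "u > 0" "v > 0" "u + v = 1"
  shows "u * f x + v * f y < f (u *\<^sub>R x + v *\<^sub>R y)"
  using assms unfolding strictly_concave_on_def strictly_convex_on_def by fastforce

lemma strictly_concave_onI:
  assumes "convex S"
    and "\<And>x y u v. x \<in> S \<Longrightarrow> y \<in> S \<Longrightarrow> x \<noteq> y \<Longrightarrow> u > 0 \<Longrightarrow> v > 0 \<Longrightarrow> u + v = 1 \<Longrightarrow>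
      u * f x + v * f y < f (u *\<^sub>R x + v *\<^sub>R y)"
  shows "strictly_concave_on S f"
  using assms unfolding strictly_concave_on_def strictly_convex_on_def by fastforce

text \<open>The mean value theorem on both sides of the intermediate point compares two slopes, and
  \<open>f'\<close> decreases strictly. Its intermediate points are positive even if the interval
  starts at 0, so continuity suffices at the endpoint. This matters because the derivatives treated
  below are often given by quotients that are singular at 0.\<close>

lemma strictly_concave_on_nonneg_realI:
  fixes f f' f'' :: "real \<Rightarrow> real"
  assumes cont: "continuous_on {0..} f"
    and f': "\<And>x. x > 0 \<Longrightarrow> (f has_real_derivative f' x) (at x)"
    and f'': "\<And>x. x > 0 \<Longrightarrow> (f' has_real_derivative f'' x) (at x)"
    and neg: "\<And>x. x > 0 \<Longrightarrow> f'' x < 0"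
  shows "strictly_concave_on {0..} f"
proof -
  have decr: "f' y < f' x" if "0 < x" "x < y" for x y
    using that by (intro DERIV_neg_imp_decreasing[of x y f']) (meson f'' neg less_le_trans)+
  have less: "u * f x + v * f y < f (u * x + v * y)"
    if xy: "0 \<le> x" "x < y" "u > 0" "v > 0" "u + v = 1" for x y u v :: real
  proof -
    define z where "z = u * x + v * y"
    have zx: "z - x = v * (y - x)" and yz: "y - z = u * (y - x)"
      using \<open>u + v = 1\<close> unfolding z_def by (algebra, algebra)
    have pos: "0 < v * (y - x)" "0 < u * (y - x)"
      using that by simp_all
    then have xz: "x < z" "z < y"
      using zx yz by linarith+
    have mvt: "\<exists>\<xi>. s < \<xi> \<and> \<xi> < t \<and> f t - f s = (t - s) * f' \<xi>" if "0 \<le> s" "s < t" for s t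
    proof -
      have "continuous_on {s..t} f"
        using that by (intro continuous_on_subset[OF cont]) auto
      with that f' obtain l \<xi> where \<xi>: "s < \<xi>" "\<xi> < t" "DERIV f \<xi> :> l" "f t - f s = (t - s) * l"
        using MVT[of s t f] by (metis le_less_trans real_differentiable_def)
      moreover have "l = f' \<xi>"
        using \<xi> that by (intro DERIV_unique[OF \<xi>(3) f']) auto
      ultimately show ?thesis by blast
    qed
    obtain \<xi> where \<xi>: "x < \<xi>" "\<xi> < z" "f z - f x = (z - x) * f' \<xi>"
      using mvt[of x z] xy xz by auto
    obtain \<eta> where \<eta>: "z < \<eta>" "\<eta> < y" "f y - f z = (y - z) * f' \<eta>"
      using mvt[of z y] xy xz by auto
    have "f' \<eta> < f' \<xi>"
      using \<xi> \<eta> that by (intro decr) auto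
    \<comment> \<open>By \<open>zx\<close> and \<open>yz\<close>, weighting the left increment by
      \<open>u\<close> and the right one by \<open>v\<close> gives both the same factor
      \<open>u * v * (y - x)\<close>.\<close>
    then have "u * (v * (y - x)) * f' \<eta> < u * (v * (y - x)) * f' \<xi>"
      using that by (intro mult_strict_left_mono) auto
    then have "v * (f y - f z) < u * (f z - f x)"
      unfolding \<xi>(3) \<eta>(3) zx yz by (simp add: algebra_simps)
    then have "u * f x + v * f y < (u + v) * f z"
      by (simp add: algebra_simps)
    then show ?thesis
      using \<open>u + v = 1\<close> by (simp add: z_def)
  qed
  show ?thesis
  proof (rule strictly_concave_onI)
    fix x y u v :: real
    assume *: "x \<in> {0..}" "y \<in> {0..}" "x \<noteq> y" "u > 0" "v > 0" "u + v = 1"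
    then consider "x < y" | "y < x" by linarith
    then show "u * f x + v * f y < f (u *\<^sub>R x + v *\<^sub>R y)"
      using less[of x y u v] less[of y x v u] * by cases (auto simp: add.commute)
  qed simp
qed

lemma continuous_on_nonneg_realI:
  fixes f :: "real \<Rightarrow> real"
  assumes "(f \<longlongrightarrow> f 0) (at_right 0)" and "\<And>x. x > 0 \<Longrightarrow> (f has_real_derivative f' x) (at x)"
  shows "continuous_on {0..} f"
proof -
  have "continuous (at x within {0..}) f" if "x \<ge> 0" for x
  proof (cases "x = 0")
    case True
    with assms(1) show ?thesis
      by (simp add: continuous_within at_within_Ici_at_right)
  next
    case False
    with that have "isCont f x"
      by (intro DERIV_isCont[OF assms(2)]) simp
    then show ?thesis
      by (rule continuous_at_imp_continuous_at_within)
  qed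
  then show ?thesis
    by (simp add: continuous_on_eq_continuous_within)
qed

section \<open>Two hyperbolic inequalities\<close>

text \<open>This is Lazarevic's inequality. After a cube root it says that \<open>g\<close>, which
  vanishes at 0, is positive at \<open>x\<close>; the derivative of \<open>g\<close> is positive. It
  gives the sign of the third derivative of \<open>ln (sinh x / x)\<close>.\<close>

lemma sinh_cubed_gt:
  assumes "(x::real) > 0"
  shows "x ^ 3 * cosh x < sinh x ^ 3"
proof -
  define g where "g = (\<lambda>x::real. sinh x * cosh x powr (- 1 / 3) - x)"
  have "\<exists>y. (g has_real_derivative y) (at t) \<and> 0 < y" if "0 < t" "t < x" for t
  proof -
    \<comment> \<open>In terms of \<open>w\<close> the derivative of \<open>g\<close> is rational,
      with numerator 2 w^6 - 3 w^4 + 1. This has double roots at 1 and -1, and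
      \<open>w > 1\<close>.\<close>
    define w where "w = cosh t powr (1 / 3)"
    have w3: "w ^ 3 = cosh t"
      by (simp add: w_def powr_powr flip: powr_numeral)
    have w1: "w > 1"
      using cosh_real_strict_mono[of 0 t] that by (simp add: w_def gr_one_powr)
    have w: "cosh t powr (- 1 / 3) = 1 / w" "cosh t powr (- 1 / 3 - 1) = 1 / w ^ 4"
    proof -
      show "cosh t powr (- 1 / 3) = 1 / w"
        unfolding w_def by (simp add: powr_minus_divide)
      have "w ^ 4 = cosh t powr (4 / 3)"
        by (simp add: w_def powr_powr flip: powr_numeral)
      then show "cosh t powr (- 1 / 3 - 1) = 1 / w ^ 4"
        using powr_minus_divide[of "cosh t" "4 / 3"] by simp
    qed
    have "(g has_real_derivative
        (cosh t * cosh t powr (- 1 / 3) + sinh t * ((- 1 / 3) * cosh t powr (- 1 / 3 - 1) * sinh t) - 1)) (at t)"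
      unfolding g_def by (auto intro!: derivative_eq_intros simp: cosh_real_pos)
    moreover have "cosh t * cosh t powr (- 1 / 3) + sinh t * ((- 1 / 3) * cosh t powr (- 1 / 3 - 1) * sinh t) - 1
        = (w - 1)\<^sup>2 * (w + 1)\<^sup>2 * (2 * w\<^sup>2 + 1) / (3 * w ^ 4)"
    proof -
      have "sinh t * sinh t = w ^ 6 - 1"
        using hyperbolic_pythagoras[of t] by (simp flip: w3 add: power2_eq_square eval_nat_numeral)
      then have "cosh t * cosh t powr (- 1 / 3) + sinh t * ((- 1 / 3) * cosh t powr (- 1 / 3 - 1) * sinh t) - 1
        = w ^ 3 / w - (w ^ 6 - 1) / (3 * w ^ 4) - 1"
        unfolding w unfolding w3[symmetric] by (simp add: field_simps)
      also have "\<dots> = (w - 1)\<^sup>2 * (w + 1)\<^sup>2 * (2 * w\<^sup>2 + 1) / (3 * w ^ 4)"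
        using w1 by (simp add: divide_simps) (simp add: algebra_simps eval_nat_numeral)
      finally show ?thesis .
    qed
    moreover have "0 < (w - 1)\<^sup>2 * (w + 1)\<^sup>2 * (2 * w\<^sup>2 + 1) / (3 * w ^ 4)"
      using w1 by (intro divide_pos_pos mult_pos_pos add_pos_pos) auto
    ultimately show ?thesis by metis
  qed
  moreover have "continuous_on {0..x} g"
    unfolding g_def by (intro continuous_intros) simp
  ultimately have "g 0 < g x"
    by (rule DERIV_pos_imp_increasing_open[OF assms])
  then have "x < sinh x * cosh x powr (- 1 / 3)"
    by (simp add: g_def)
  then have "x ^ 3 < (sinh x * cosh x powr (- 1 / 3)) ^ 3"
    using assms by (intro power_strict_mono) auto
  also have "\<dots> = sinh x ^ 3 / cosh x"
  proof -
    have "(cosh x powr (1 / 3)) ^ 3 = cosh x"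
      by (simp add: powr_powr flip: powr_numeral)
    then show ?thesis
      by (simp add: powr_minus_divide power_divide)
  qed
  finally show ?thesis
    by (simp add: field_simps)
qed

text \<open>A hyperbolic Cusa-Huygens inequality. The difference of the two sides and its first two
  derivatives vanish at 0, and the third derivative \<open>t * sinh t\<close> is positive for
  \<open>t > 0\<close>; facts 1 and 2 climb back up by \<open>incr\<close>. At the argument
  \<open>2 * x\<close> it settles the identric case.\<close>

lemma three_sinh_less:
  assumes "(x::real) > 0"
  shows "3 * sinh x < 2 * x + x * cosh x"
proof -
  have incr: "g 0 < g t" if "t > 0" "\<And>s. (g has_real_derivative g' s) (at s)" "\<And>s. s > 0 \<Longrightarrow> 0 < g' s"
    for g g' :: "real \<Rightarrow> real" and t
  proof (rule DERIV_pos_imp_increasing_open[OF that(1)])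
    show "continuous_on {0..t} g"
      by (intro continuous_at_imp_continuous_on ballI DERIV_isCont[OF that(2)])
    show "\<exists>y. (g has_real_derivative y) (at s) \<and> 0 < y" if "0 < s" for s
      using \<open>\<And>s. (g has_real_derivative g' s) (at s)\<close> \<open>\<And>s. s > 0 \<Longrightarrow> 0 < g' s\<close> that by blast
  qed
  have 1: "0 < t * cosh t - sinh t" if "t > 0" for t :: real
  proof -
    have "((\<lambda>t. t * cosh t - sinh t) has_real_derivative s * sinh s) (at s)" for s :: real
      by (auto intro!: derivative_eq_intros)
    from incr[OF that this] show ?thesis by simp
  qed
  have 2: "0 < 2 - 2 * cosh t + t * sinh t" if "t > 0" for t :: real
  proof -
    have "((\<lambda>t. 2 - 2 * cosh t + t * sinh t) has_real_derivative s * cosh s - sinh s) (at s)" for s :: real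
      by (auto intro!: derivative_eq_intros)
    from incr[OF that this 1] show ?thesis by simp
  qed
  have "((\<lambda>t. 2 * t + t * cosh t - 3 * sinh t) has_real_derivative 2 - 2 * cosh s + s * sinh s) (at s)"
    for s :: real
    by (auto intro!: derivative_eq_intros)
  from incr[OF assms this 2] show ?thesis by simp
qed

subsection \<open>Divided differences\<close>

text \<open>\<open>f\<close> stands for the derivative of \<open>F\<close>. Passing it separately
  fixes the diagonal value by an explicit formula, also at 0.\<close>

definition divided_difference :: "(real \<Rightarrow> real) \<Rightarrow> (real \<Rightarrow> real) \<Rightarrow> real \<Rightarrow> real \<Rightarrow> real" where
  "divided_difference F f p q = (if p = q then f p else (F p - F q) / (p - q))"

text \<open>
  The divided difference is the mean of \<open>f\<close> over the segment from \<open>q\<close> to \<open>p\<close>; the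
  proof works with an antiderivative in the segment parameter \<open>s\<close>. Concavity of \<open>f\<close> is
  strict at every \<open>s\<close> but at most one, as two distinct points \<open>(p, q)\<close> agree in at most one
  \<open>s * p + (1 - s) * q\<close>.
\<close>

lemma strictly_concave_on_divided_difference:
  assumes cont: "continuous_on {0..} F"
    and deriv: "\<And>x. x > 0 \<Longrightarrow> (F has_real_derivative f x) (at x)"
    and conc: "strictly_concave_on {0..} f"
  shows "strictly_concave_on ({0..} \<times> {0..}) (\<lambda>(p, q). divided_difference F f p q)"
proof (rule strictly_concave_onI)
  show "convex ({0..} \<times> {0..} :: (real \<times> real) set)"
    by (intro convex_Times) simp_all
next
  fix x y :: "real \<times> real" and u v :: real
  assume xy: "x \<in> {0..} \<times> {0..}" "y \<in> {0..} \<times> {0..}" "x \<noteq> y" and uv: "u > 0" "v > 0" "u + v = 1"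
  define z where "z = u *\<^sub>R x + v *\<^sub>R y"
  define l where "l = (\<lambda>(p, q) s. s * p + (1 - s) * q :: real)"
  \<comment> \<open>An antiderivative of \<open>f (l w s)\<close> in \<open>s\<close>: on the
    diagonal \<open>l w\<close> is constant, elsewhere it is affine with slope
    \<open>fst w - snd w\<close>.\<close>
  define H where "H = (\<lambda>w s. if fst w = snd w then s * f (fst w) else F (l w s) / (fst w - snd w))"
  have z: "z \<in> {0..} \<times> {0..}"
    using xy uv by (auto simp: z_def)
  have l_z: "l z s = u *\<^sub>R l x s + v *\<^sub>R l y s" for s
    by (simp add: z_def l_def split_beta algebra_simps)
  have l_nonneg: "0 \<le> l w s" if "w \<in> {0..} \<times> {0..}" "s \<in> {0..1}" for w s
    using that by (auto simp: l_def split_beta)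
  have H_cont: "continuous_on {0..1} (H w)" if w: "w \<in> {0..} \<times> {0..}" for w
  proof (cases "fst w = snd w")
    case False
    have "continuous_on {0..1} (\<lambda>s. F (l w s))"
      using l_nonneg[OF w]
      by (intro continuous_on_compose2[OF cont]) (auto simp: l_def split_beta intro!: continuous_intros)
    with False show ?thesis
      by (auto simp: H_def intro!: continuous_intros)
  qed (auto simp: H_def intro!: continuous_intros)
  have H_deriv: "(H w has_real_derivative f (l w s)) (at s)"
    if w: "w \<in> {0..} \<times> {0..}" and s: "0 < s" "s < 1" for w s
  proof (cases "fst w = snd w")
    case True
    then have "l w s = fst w"
      by (simp add: l_def split_beta algebra_simps)
    with True show ?thesis
      by (auto simp: H_def intro!: derivative_eq_intros)
  next
    case False
    \<comment> \<open>Off the diagonal an interior point of the segment is positive even if one end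
      is 0, so \<open>deriv\<close> applies there.\<close>
    have "0 < fst w \<or> 0 < snd w"
      using w False by (cases w) auto
    then have "0 < l w s"
      using w s by (cases w) (auto simp: l_def intro: add_pos_nonneg add_nonneg_pos)
    note deriv[OF this]
    moreover have "(l w has_real_derivative (fst w - snd w)) (at s)"
      unfolding l_def split_beta by (auto intro!: derivative_eq_intros)
    ultimately have "((\<lambda>s. F (l w s)) has_real_derivative f (l w s) * (fst w - snd w)) (at s)"
      by (rule DERIV_chain2)
    then have "((\<lambda>s. F (l w s) / (fst w - snd w)) has_real_derivative
        f (l w s) * (fst w - snd w) / (fst w - snd w)) (at s)"
      by (rule DERIV_cdivide)
    with False show ?thesis
      by (simp add: H_def)
  qed
  have H_diff: "H w 1 - H w 0 = (case w of (p, q) \<Rightarrow> divided_difference F f p q)" for w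
    by (cases w) (simp add: H_def l_def divided_difference_def diff_divide_distrib)

  \<comment> \<open>\<open>K 1 - K 0\<close> is the concavity gap of the divided difference, and the
    derivative of \<open>K\<close> is the concavity gap of \<open>f\<close> along the
    segments.\<close>
  define K where "K = (\<lambda>s. H z s - (u * H x s + v * H y s))"
  have K_cont: "continuous_on {0..1} K"
    unfolding K_def using H_cont xy z by (intro continuous_intros) auto
  have K_deriv: "(K has_real_derivative (f (l z s) - (u * f (l x s) + v * f (l y s)))) (at s)"
    if "0 < s" "s < 1" for s
    unfolding K_def using H_deriv[OF z that] H_deriv[OF xy(1) that] H_deriv[OF xy(2) that]
    by (auto intro!: derivative_eq_intros)
  have pos: "0 < f (l z s) - (u * f (l x s) + v * f (l y s))" if "0 < s" "s < 1" "l x s \<noteq> l y s" for s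
    using strictly_concave_onD[OF conc, of "l x s" "l y s" u v] that uv l_nonneg xy
    by (simp add: l_z)
  \<comment> \<open>\<open>r\<close> is the only parameter where the gap of \<open>f\<close> may
    vanish; if there is none, 1/2 is a placeholder.\<close>
  obtain r where r: "0 < r" "r < 1" and r_unique: "\<And>s. 0 < s \<Longrightarrow> s < 1 \<Longrightarrow> l x s = l y s \<Longrightarrow> s = r"
  proof (cases "\<exists>r. 0 < r \<and> r < 1 \<and> l x r = l y r")
    case True
    then obtain r where r: "0 < r" "r < 1" "l x r = l y r" by blast
    have "s = r" if "l x s = l y s" for s
    proof (rule ccontr)
      assume "s \<noteq> r"
      define dp dq where "dp = fst x - fst y" and "dq = snd x - snd y"
      \<comment> \<open>A homogeneous linear system with determinant \<open>r - s\<close>, so it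
        forces \<open>x = y\<close>.\<close>
      have "r * dp + (1 - r) * dq = 0" "s * dp + (1 - s) * dq = 0"
        using r that by (simp_all add: l_def split_beta dp_def dq_def algebra_simps)
      moreover from this have "(s - r) * (dp - dq) = 0"
        by algebra
      ultimately have "dp = 0" "dq = 0"
        using \<open>s \<noteq> r\<close> by (simp_all add: left_diff_distrib)
      with xy(3) show False
        by (simp add: dp_def dq_def prod_eq_iff)
    qed
    with r that show ?thesis by blast
  next
    case False
    then show ?thesis
      using that[of "1/2"] by fastforce
  qed
  have K_deriv_pos: "\<exists>y. (K has_real_derivative y) (at s) \<and> 0 < y" if "0 < s" "s < 1" "s \<noteq> r" for s
    using K_deriv pos r_unique that by blast
  \<comment> \<open>Strict growth on each side of \<open>r\<close> avoids the one point where the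
    derivative may be 0.\<close>
  have "K 0 < K r"
    by (rule DERIV_pos_imp_increasing_open[OF r(1) K_deriv_pos continuous_on_subset[OF K_cont]])
      (use r in auto)
  also have "K r < K 1"
    by (rule DERIV_pos_imp_increasing_open[OF r(2) K_deriv_pos continuous_on_subset[OF K_cont]])
      (use r in auto)
  finally have "0 < (H z 1 - H z 0) - (u * (H x 1 - H x 0) + v * (H y 1 - H y 0))"
    by (simp add: K_def algebra_simps)
  then show "u * (case x of (p, q) \<Rightarrow> divided_difference F f p q)
      + v * (case y of (p, q) \<Rightarrow> divided_difference F f p q)
      < (case u *\<^sub>R x + v *\<^sub>R y of (p, q) \<Rightarrow> divided_difference F f p q)"
    unfolding H_diff by (simp add: z_def)
qed

text \<open>Evenness of \<open>F\<close> and oddness of \<open>f\<close> make the divided difference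
  odd under negating both arguments. Hence \<open>c * D (c w) = d * D (d w)\<close> with
  \<open>d\<close> the absolute value of \<open>c\<close>, so the sign of \<open>c\<close> is
  immaterial, and scaling by \<open>d > 0\<close> preserves both quadrants. Convexity on the
  nonpositive quadrant is concavity at the reflected points.\<close>

lemma strictly_bivariate_log_concave_convex_even:
  assumes cont: "continuous_on {0..} F"
    and deriv: "\<And>x. x > 0 \<Longrightarrow> (F has_real_derivative f x) (at x)"
    and conc: "strictly_concave_on {0..} f"
    and even: "\<And>x. F (- x) = F x" and odd: "\<And>x. f (- x) = - f x"
    and "c \<noteq> 0"
    and M: "\<And>p q. M p q = exp (m + c * divided_difference F f (c * p) (c * q))"
  shows "strictly_bivariate_log_concave_on ({0..} \<times> {0..}) (\<lambda>(p, q). M p q) \<and>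
     strictly_bivariate_log_convex_on ({..0} \<times> {..0}) (\<lambda>(p, q). M p q)"
proof -
  define D where "D = (\<lambda>(p, q). divided_difference F f p q)"
  define d where "d = \<bar>c\<bar>"
  have d: "d > 0"
    using \<open>c \<noteq> 0\<close> by (simp add: d_def)
  have D_neg: "D (- w) = - D w" for w
    by (cases w) (auto simp: D_def divided_difference_def even odd divide_simps, simp add: algebra_simps)
  have ln_M: "ln (case w of (p, q) \<Rightarrow> M p q) = m + d * D (d *\<^sub>R w)" for w
    using D_neg[of "c *\<^sub>R w"] by (cases w) (simp add: M D_def d_def abs_if)
  have D: "strictly_concave_on ({0..} \<times> {0..}) D"
    unfolding D_def by (rule strictly_concave_on_divided_difference[OF cont deriv conc])
  have D_less: "u * D x + v * D y < D (u *\<^sub>R x + v *\<^sub>R y)"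
    if "x \<in> {0..} \<times> {0..}" "y \<in> {0..} \<times> {0..}" "x \<noteq> y" "u > 0" "v > 0" "u + v = 1" for x y u v
    using strictly_concave_onD[OF D that] .
  have concave: "u * (m + d * D (d *\<^sub>R x)) + v * (m + d * D (d *\<^sub>R y)) < m + d * D (d *\<^sub>R (u *\<^sub>R x + v *\<^sub>R y))"
    if "x \<in> {0..} \<times> {0..}" "y \<in> {0..} \<times> {0..}" "x \<noteq> y" "u > 0" "v > 0" "u + v = 1" for x y u v
  proof -
    have "u * D (d *\<^sub>R x) + v * D (d *\<^sub>R y) < D (u *\<^sub>R d *\<^sub>R x + v *\<^sub>R d *\<^sub>R y)"
      using that d by (intro D_less) (auto simp: mem_Times_iff)
    then have "(u + v) * m + d * (u * D (d *\<^sub>R x) + v * D (d *\<^sub>R y))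
        < m + d * D (u *\<^sub>R d *\<^sub>R x + v *\<^sub>R d *\<^sub>R y)"
      using d that by simp
    then show ?thesis
      by (simp add: algebra_simps)
  qed
  have convex: "m + d * D (d *\<^sub>R (u *\<^sub>R x + v *\<^sub>R y)) < u * (m + d * D (d *\<^sub>R x)) + v * (m + d * D (d *\<^sub>R y))"
    if "x \<in> {..0} \<times> {..0}" "y \<in> {..0} \<times> {..0}" "x \<noteq> y" "u > 0" "v > 0" "u + v = 1" for x y u v
  proof -
    have "u * D (d *\<^sub>R - x) + v * D (d *\<^sub>R - y) < D (u *\<^sub>R d *\<^sub>R - x + v *\<^sub>R d *\<^sub>R - y)"
      using that d by (intro D_less) (auto simp: mem_Times_iff mult_nonneg_nonpos)
    also have "D (u *\<^sub>R d *\<^sub>R - x + v *\<^sub>R d *\<^sub>R - y) = - D (u *\<^sub>R d *\<^sub>R x + v *\<^sub>R d *\<^sub>R y)"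
      by (simp flip: D_neg)
    finally have "D (u *\<^sub>R d *\<^sub>R x + v *\<^sub>R d *\<^sub>R y) < u * D (d *\<^sub>R x) + v * D (d *\<^sub>R y)"
      by (simp add: D_neg)
    then have "m + d * D (u *\<^sub>R d *\<^sub>R x + v *\<^sub>R d *\<^sub>R y)
        < (u + v) * m + d * (u * D (d *\<^sub>R x) + v * D (d *\<^sub>R y))"
      using d that by simp
    then show ?thesis
      by (simp add: algebra_simps)
  qed
  have "strictly_concave_on ({0..} \<times> {0..}) (\<lambda>w. ln (case w of (p, q) \<Rightarrow> M p q))"
    unfolding ln_M by (intro strictly_concave_onI concave convex_Times) auto
  moreover have "strictly_convex_on ({..0} \<times> {..0}) (\<lambda>w. ln (case w of (p, q) \<Rightarrow> M p q))"
    unfolding ln_M strictly_convex_on_def by (intro conjI ballI allI impI convex convex_Times) auto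
  ultimately show ?thesis
    unfolding strictly_bivariate_log_concave_on_def strictly_bivariate_log_convex_on_def
    by (auto simp: M split_beta)
qed

text \<open>The off-diagonal case common to all four means. The constant \<open>A\<close> cancels in
  the quotient, so it may even be negative.\<close>

lemma ratio_powr_eq_exp_divided_difference:
  fixes m c :: real
  assumes "p \<noteq> q" "c \<noteq> 0" "A \<noteq> 0" and E: "\<And>t. E t = A * exp (m * t + F (c * t))"
  shows "(E p / E q) powr (1 / (p - q)) = exp (m + c * divided_difference F f (c * p) (c * q))"
proof -
  have "E p / E q = exp ((m * p + F (c * p)) - (m * q + F (c * q)))"
    using \<open>A \<noteq> 0\<close> unfolding E exp_diff by simp
  then have "(E p / E q) powr (1 / (p - q)) = exp (((m * p + F (c * p)) - (m * q + F (c * q))) / (p - q))"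
    by (simp add: powr_def)
  also have "((m * p + F (c * p)) - (m * q + F (c * q))) / (p - q)
      = m + c * divided_difference F f (c * p) (c * q)"
    using assms(1,2) by (simp add: divided_difference_def divide_simps) (simp add: algebra_simps)
  finally show ?thesis .
qed

subsection \<open>The means in exponential coordinates\<close>

lemma exp_add_minus_exp_diff: "exp (h + k) - exp (h - k) = 2 * exp h * sinh (k::real)"
  by (simp add: sinh_def exp_add exp_diff exp_minus field_simps)

lemma exp_add_plus_exp_diff: "exp (h + k) + exp (h - k) = 2 * exp h * cosh (k::real)"
  by (simp add: cosh_def exp_add exp_diff exp_minus field_simps)

lemma exp_add_powr: "exp (m + c) powr t = exp (m * t + c * t)"
  and exp_diff_powr: "exp (m - c) powr t = exp (m * t - c * (t::real))"
  by (simp_all add: powr_def algebra_simps)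

lemma sqrt_exp_add_mult_exp_diff: "sqrt (exp (m + c) * exp (m - c)) = exp m"
  by (rule real_sqrt_unique) (simp_all add: power2_eq_square flip: exp_add)

text \<open>The numerator splits into \<open>m\<close> times the difference and \<open>c\<close>
  times the sum of the exponentials. The pairs \<open>h\<close>, \<open>k\<close> and
  \<open>m\<close>, \<open>c\<close> are independent: they coincide for the identric mean, while the
  diagonal Stolarsky mean has \<open>h = m * p\<close> and \<open>k = c * p\<close>.\<close>

lemma weighted_exponent_diff_quotient:
  assumes "k \<noteq> 0"
  shows "(exp (h + k) * (m + c) - exp (h - k) * (m - c)) / (exp (h + k) - exp (h - k))
    = m + c * (cosh k / sinh (k::real))"
proof -
  have "exp (h + k) * (m + c) - exp (h - k) * (m - c)
      = m * (exp (h + k) - exp (h - k)) + c * (exp (h + k) + exp (h - k))"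
    by (simp add: algebra_simps)
  then show ?thesis
    unfolding exp_add_minus_exp_diff exp_add_plus_exp_diff using assms by (simp add: field_simps)
qed

lemma identric_mean_exp:
  "identric_mean (exp (h + k)) (exp (h - k)) = exp (h + (if k = 0 then 0 else k * cosh k / sinh k - 1))"
proof (cases "k = 0")
  case False
  have "identric_mean (exp (h + k)) (exp (h - k))
      = exp (- 1 + (exp (h + k) * (h + k) - exp (h - k) * (h - k)) / (exp (h + k) - exp (h - k)))"
    using False by (simp add: identric_mean_def powr_def flip: exp_diff exp_add)
  also have "(exp (h + k) * (h + k) - exp (h - k) * (h - k)) / (exp (h + k) - exp (h - k))
      = h + k * (cosh k / sinh k)"
    using False by (rule weighted_exponent_diff_quotient)
  finally show ?thesis
    using False by (simp add: algebra_simps)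
qed (simp add: identric_mean_def)

text \<open>Here G = e^h and L = e^h sinh k / k, and the 1 in the exponent of Y cancels the -1 from
  the identric mean. What multiplies \<open>k\<close> is the derivative of k coth k, which makes Y
  the diagonal of the identric family.\<close>

lemma Y_mean_exp:
  assumes "k \<noteq> 0"
  shows "Y_mean (exp (h + k)) (exp (h - k)) = exp (h + k * (cosh k / sinh k - k / (sinh k)\<^sup>2))"
proof -
  have "logarithmic_mean (exp (h + k)) (exp (h - k)) = exp h * sinh k / k"
    using assms by (simp add: logarithmic_mean_def exp_add_minus_exp_diff)
  then have "(geometric_mean (exp (h + k)) (exp (h - k)))\<^sup>2 / (logarithmic_mean (exp (h + k)) (exp (h - k)))\<^sup>2
      = k * (k / (sinh k)\<^sup>2)"
    unfolding geometric_mean_def sqrt_exp_add_mult_exp_diff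
    by (simp add: power_divide power_mult_distrib power2_eq_square[of k])
  then show ?thesis
    using assms unfolding Y_mean_def identric_mean_exp
    by (simp add: right_diff_distrib flip: exp_add)
qed

definition sinhc :: "real \<Rightarrow> real" where
  "sinhc x = (if x = 0 then 1 else sinh x / x)"

lemma sinhc_pos: "0 < sinhc x"
  by (auto simp: sinhc_def zero_less_divide_iff)

lemma stolarsky_mean_exp:
  fixes m c :: real
  assumes "c \<noteq> 0"
  shows "stolarsky_mean p q (exp (m + c)) (exp (m - c)) = exp (m + c *
    divided_difference (\<lambda>x. ln (sinhc x)) (\<lambda>x. cosh x / sinh x - 1 / x) (c * p) (c * q))"
proof (cases "p = q")
  case False
  \<comment> \<open>\<open>E t\<close> is (a^t - b^t) / t, extended to \<open>t = 0\<close> by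
    \<open>ln a - ln b = 2 * c\<close>. The branches with one zero parameter thus become instances
    of the general quotient.\<close>
  define E where "E = (\<lambda>t. 2 * c * exp (m * t + ln (sinhc (c * t))))"
  have E_neq: "E t \<noteq> 0" and E_pos: "0 < E t / E s" for s t
    using assms by (auto simp: E_def zero_less_divide_iff)
  have E0: "E 0 = 2 * c"
    by (simp add: E_def sinhc_def)
  have diff: "exp (m + c) powr t - exp (m - c) powr t = t * E t" for t
    unfolding exp_add_powr exp_diff_powr exp_add_minus_exp_diff
    by (simp add: E_def exp_add sinhc_pos) (simp add: sinhc_def assms)
  \<comment> \<open>Reconciles the branch \<open>p = 0\<close>, written with exponent
    \<open>1 / q\<close>, with the general exponent \<open>1 / (p - q)\<close>.\<close>
  have flip: "(E 0 / E t) powr (1 / (0 - t)) = (E t / E 0) powr (1 / t)" for t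
  proof -
    have "E 0 / E t = inverse (E t / E 0)"
      by simp
    then show ?thesis
      using E_pos[of t 0] E_neq by (simp add: powr_def ln_inverse del: inverse_divide)
  qed
  have "stolarsky_mean p q (exp (m + c)) (exp (m - c)) = (E p / E q) powr (1 / (p - q))"
    using False flip[of q] unfolding stolarsky_mean_def diff by (auto simp: E0)
  also have "\<dots> = exp (m + c *
      divided_difference (\<lambda>x. ln (sinhc x)) (\<lambda>x. cosh x / sinh x - 1 / x) (c * p) (c * q))"
    by (rule ratio_powr_eq_exp_divided_difference[OF False assms, of "2 * c"]) (simp_all add: E_def assms)
  finally show ?thesis .
next
  \<comment> \<open>At \<open>p = q = 0\<close> division by zero makes the diagonal term 0, leaving
    \<open>exp m\<close>, the geometric mean.\<close>
  case True
  then show ?thesis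
    using weighted_exponent_diff_quotient[of "c * p" "m * p" m c] assms
    by (simp add: stolarsky_mean_def divided_difference_def exp_add_powr exp_diff_powr
      sqrt_exp_add_mult_exp_diff right_diff_distrib)
qed

lemma gini_mean_exp:
  assumes "c \<noteq> 0"
  shows "gini_mean p q (exp (m + c)) (exp (m - c)) = exp (m + c *
    divided_difference (\<lambda>x. ln (cosh x)) tanh (c * p) (c * q))"
proof (cases "p = q")
  case False
  have "exp (m + c) powr t + exp (m - c) powr t = 2 * exp (m * t + ln (cosh (c * t)))" for t
    unfolding exp_add_powr exp_diff_powr exp_add_plus_exp_diff by (simp add: exp_add)
  from ratio_powr_eq_exp_divided_difference[OF False assms _ this] False show ?thesis
    unfolding gini_mean_def by simp
next
  case True
  have "exp (m * p + c * p) * (m + c) + exp (m * p - c * p) * (m - c)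
      = m * (exp (m * p + c * p) + exp (m * p - c * p)) + c * (exp (m * p + c * p) - exp (m * p - c * p))"
    by (simp add: algebra_simps)
  then have "(exp (m * p + c * p) * (m + c) + exp (m * p - c * p) * (m - c)) /
      (exp (m * p + c * p) + exp (m * p - c * p)) = m + c * tanh (c * p)"
    unfolding exp_add_plus_exp_diff exp_add_minus_exp_diff by (simp add: tanh_def field_simps)
  with True show ?thesis
    by (simp add: gini_mean_def divided_difference_def exp_add_powr exp_diff_powr)
qed

lemma identric_mean2_exp:
  assumes "c \<noteq> 0"
  shows "identric_mean2 p q (exp (m + c)) (exp (m - c)) = exp (m + c *
    divided_difference (\<lambda>x. if x = 0 then 0 else x * cosh x / sinh x - 1)
      (\<lambda>x. cosh x / sinh x - x / (sinh x)\<^sup>2) (c * p) (c * q))"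
proof (cases "p = q")
  case False
  \<comment> \<open>The factor 1 plays the part of the constant \<open>A\<close> in the quotient
    lemma.\<close>
  have "identric_mean (exp (m + c) powr t) (exp (m - c) powr t)
      = 1 * exp (m * t + (if c * t = 0 then 0 else c * t * cosh (c * t) / sinh (c * t) - 1))" for t
    unfolding exp_add_powr exp_diff_powr identric_mean_exp by simp
  from ratio_powr_eq_exp_divided_difference[OF False assms _ this] False show ?thesis
    unfolding identric_mean2_def by simp
next
  case True
  have "Y_mean (exp (m + c) powr p) (exp (m - c) powr p) powr (1 / p)
      = exp (m + c * (cosh (c * p) / sinh (c * p) - c * p / (sinh (c * p))\<^sup>2))" if "p \<noteq> 0"
    unfolding exp_add_powr exp_diff_powr using that assms
    by (simp add: Y_mean_exp powr_def add_divide_distrib)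
  with True show ?thesis
    by (simp add: identric_mean2_def divided_difference_def sqrt_exp_add_mult_exp_diff)
qed

lemma heronian_mean2_exp:
  assumes "c \<noteq> 0"
  shows "heronian_mean2 p q (exp (m + c)) (exp (m - c)) = exp (m + c *
    divided_difference (\<lambda>x. ln (1 + 2 * cosh x)) (\<lambda>x. 2 * sinh x / (1 + 2 * cosh x)) (c * p) (c * q))"
proof -
  have pos: "0 < 1 + 2 * cosh x" for x :: real
    by (simp add: add_pos_pos)
  have E: "exp (m + c) powr t + exp m powr t + exp (m - c) powr t = 1 * exp (m * t + ln (1 + 2 * cosh (c * t)))" for t
  proof -
    have "exp (m + c) powr t + exp m powr t + exp (m - c) powr t = exp (m * t) * (1 + 2 * cosh (c * t))"
      \<comment> \<open>The middle term is the power rule with \<open>c = 0\<close>.\<close>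
      using exp_add_plus_exp_diff[of "m * t" "c * t"] exp_add_powr[of m 0 t]
      by (simp add: exp_add_powr exp_diff_powr distrib_left)
    with pos[of "c * t"] show ?thesis
      by (simp add: exp_add)
  qed
  show ?thesis
  proof (cases "p = q")
    case False
    from ratio_powr_eq_exp_divided_difference[OF False assms _ E] False show ?thesis
      unfolding heronian_mean2_def sqrt_exp_add_mult_exp_diff by simp
  next
    case True
    define A B C where "A = exp (m + c) powr p" and "B = exp m powr p" and "C = exp (m - c) powr p"
    have sum: "A + B + C = exp (m * p) * (1 + 2 * cosh (c * p))"
      using E[of p] pos[of "c * p"] by (simp add: A_def B_def C_def exp_add)
    have diff: "A - C = exp (m * p) * (2 * sinh (c * p))"
      by (simp add: A_def C_def exp_add_powr exp_diff_powr exp_add_minus_exp_diff)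
    define N where "N = A + B + C"
    have "heronian_mean2 p q (exp (m + c)) (exp (m - c))
        = exp (m + c) powr ((A + B / 2) / N) * exp (m - c) powr ((B / 2 + C) / N)"
      using True unfolding heronian_mean2_def sqrt_exp_add_mult_exp_diff N_def A_def B_def C_def by simp
    also have "\<dots> = exp ((A + B / 2) / N * (m + c) + (B / 2 + C) / N * (m - c))"
      by (simp add: powr_def mult_exp_exp)
    \<comment> \<open>The two weights add up to 1, and the halves of \<open>B\<close> cancel in
      their difference, leaving \<open>m + c * (A - C) / N\<close>.\<close>
    also have "(A + B / 2) / N * (m + c) + (B / 2 + C) / N * (m - c)
        = ((A + B / 2) * (m + c) + (B / 2 + C) * (m - c)) / N"
      by (simp only: times_divide_eq_left flip: add_divide_distrib)
    also have "(A + B / 2) * (m + c) + (B / 2 + C) * (m - c) = m * N + c * (A - C)"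
      by (simp add: N_def field_simps)
    also have "(m * N + c * (A - C)) / N = m + c * ((A - C) / N)"
      using pos[of "c * p"] sum by (simp add: N_def add_divide_distrib)
    also have "(A - C) / N = 2 * sinh (c * p) / (1 + 2 * cosh (c * p))"
      unfolding N_def sum diff by simp
    finally show ?thesis
      using True by (simp add: divided_difference_def)
  qed
qed

subsection \<open>Strict concavity of the derivatives\<close>

text \<open>
  Since \<open>x / 0 = 0\<close>, the quotients with denominator \<open>x\<close> or \<open>sinh x\<close> take the value of their
  continuous extension at \<open>0\<close>.
\<close>

lemma strictly_concave_deriv_ln_sinhc:
  "strictly_concave_on {0..} (\<lambda>x::real. cosh x / sinh x - 1 / x)" (is "strictly_concave_on _ ?f")
proof (rule strictly_concave_on_nonneg_realI)
  show f': "(?f has_real_derivative 1 / x\<^sup>2 - 1 / (sinh x)\<^sup>2) (at x)" if "x > 0" for x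
  proof -
    have "(?f has_real_derivative ((sinh x)\<^sup>2 - (cosh x)\<^sup>2) / (sinh x)\<^sup>2 + 1 / x\<^sup>2) (at x)"
      using that by (auto intro!: derivative_eq_intros simp: field_simps power2_eq_square)
    then show ?thesis
      by (simp add: sinh_square_eq)
  qed
  show "continuous_on {0..} ?f"
  proof (rule continuous_on_nonneg_realI)
    have "(?f \<longlongrightarrow> 0) (at_right 0)"
      by real_asymp
    then show "(?f \<longlongrightarrow> ?f 0) (at_right 0)"
      by simp
  qed (fact f')
  fix x :: real assume x: "x > 0"
  show "((\<lambda>x. 1 / x\<^sup>2 - 1 / (sinh x)\<^sup>2) has_real_derivative 2 * cosh x / sinh x ^ 3 - 2 / x ^ 3) (at x)"
    using x by (auto intro!: derivative_eq_intros simp: field_simps eval_nat_numeral)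
  \<comment> \<open>Clearing denominators turns this into Lazarevic's inequality.\<close>
  show "2 * cosh x / sinh x ^ 3 - 2 / x ^ 3 < 0"
    using x sinh_cubed_gt[OF x] by (simp add: field_simps)
qed

lemma strictly_concave_deriv_x_coth:
  "strictly_concave_on {0..} (\<lambda>x::real. cosh x / sinh x - x / (sinh x)\<^sup>2)" (is "strictly_concave_on _ ?f")
proof (rule strictly_concave_on_nonneg_realI)
  show f': "(?f has_real_derivative 2 * x * cosh x / sinh x ^ 3 - 2 / (sinh x)\<^sup>2) (at x)" if "x > 0" for x
  proof -
    have "(?f has_real_derivative ((sinh x)\<^sup>2 - (cosh x)\<^sup>2) / (sinh x)\<^sup>2
        + 2 * x * cosh x / sinh x ^ 3 - 1 / (sinh x)\<^sup>2) (at x)"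
      using that by (auto intro!: derivative_eq_intros simp: field_simps eval_nat_numeral)
    then show ?thesis
      by (simp add: sinh_square_eq)
  qed
  show "continuous_on {0..} ?f"
  proof (rule continuous_on_nonneg_realI)
    have "(?f \<longlongrightarrow> 0) (at_right 0)"
      by real_asymp
    then show "(?f \<longlongrightarrow> ?f 0) (at_right 0)"
      by simp
  qed (fact f')
  fix x :: real assume x: "x > 0"
  have "((\<lambda>x. 2 * x * cosh x / sinh x ^ 3 - 2 / (sinh x)\<^sup>2) has_real_derivative
      (6 * sinh x * cosh x + 2 * x * (sinh x)\<^sup>2 - 6 * x * (cosh x)\<^sup>2) / sinh x ^ 4) (at x)"
    using x by (auto intro!: derivative_eq_intros simp: field_simps eval_nat_numeral)
  \<comment> \<open>Doubling the argument makes the numerator linear in the hyperbolic functions, in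
    the shape of \<open>three_sinh_less\<close>.\<close>
  also have "6 * sinh x * cosh x + 2 * x * (sinh x)\<^sup>2 - 6 * x * (cosh x)\<^sup>2
      = 3 * sinh (2 * x) - 2 * (2 * x) - 2 * x * cosh (2 * x)"
    unfolding sinh_double cosh_double using hyperbolic_pythagoras[of x] by algebra
  finally show "((\<lambda>x. 2 * x * cosh x / sinh x ^ 3 - 2 / (sinh x)\<^sup>2) has_real_derivative
      (3 * sinh (2 * x) - 2 * (2 * x) - 2 * x * cosh (2 * x)) / sinh x ^ 4) (at x)" .
  show "(3 * sinh (2 * x) - 2 * (2 * x) - 2 * x * cosh (2 * x)) / sinh x ^ 4 < 0"
    using x three_sinh_less[of "2 * x"] by (simp add: divide_less_0_iff)
qed

lemma strictly_concave_tanh: "strictly_concave_on {0..} (tanh :: real \<Rightarrow> real)"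
proof (rule strictly_concave_on_nonneg_realI)
  show deriv: "(tanh has_real_derivative 1 - (tanh x)\<^sup>2) (at x)" for x :: real
    by (auto intro!: derivative_eq_intros)
  show "continuous_on {0..} (tanh :: real \<Rightarrow> real)"
    by (intro continuous_at_imp_continuous_on ballI DERIV_isCont[OF deriv])
  fix x :: real assume x: "x > 0"
  show "((\<lambda>x. 1 - (tanh x)\<^sup>2) has_real_derivative - (2 * tanh x * (1 - (tanh x)\<^sup>2))) (at x)"
    by (auto intro!: derivative_eq_intros)
  have "(tanh x)\<^sup>2 < 1"
    using tanh_real_bounds[of x] by (simp add: abs_square_less_1 abs_less_iff)
  with x show "- (2 * tanh x * (1 - (tanh x)\<^sup>2)) < 0"
    by simp
qed

lemma strictly_concave_deriv_ln_one_plus_two_cosh: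
  "strictly_concave_on {0..} (\<lambda>x::real. 2 * sinh x / (1 + 2 * cosh x))"
proof (rule strictly_concave_on_nonneg_realI)
  have pos: "1 + 2 * cosh x > 0" for x :: real
    by (simp add: add_pos_pos)
  then have neq: "1 + 2 * cosh x \<noteq> 0" for x :: real
    by (metis less_irrefl)
  show "continuous_on {0..} (\<lambda>x::real. 2 * sinh x / (1 + 2 * cosh x))"
    by (intro continuous_intros ballI neq)
  fix x :: real assume x: "x > 0"
  show "((\<lambda>x. 2 * sinh x / (1 + 2 * cosh x)) has_real_derivative
      2 * (cosh x + 2) / (1 + 2 * cosh x)\<^sup>2) (at x)"
  proof -
    have "((\<lambda>x. 2 * sinh x / (1 + 2 * cosh x)) has_real_derivative
      (2 * cosh x * (1 + 2 * cosh x) - 4 * (sinh x)\<^sup>2) / (1 + 2 * cosh x)\<^sup>2) (at x)"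
      using neq by (auto intro!: derivative_eq_intros simp: power2_eq_square)
    also have "2 * cosh x * (1 + 2 * cosh x) - 4 * (sinh x)\<^sup>2 = 2 * (cosh x + 2)"
      using hyperbolic_pythagoras[of x] by algebra
    finally show ?thesis .
  qed
  have "((\<lambda>x. 2 * (cosh x + 2) / (1 + 2 * cosh x)\<^sup>2) has_real_derivative
      (2 * sinh x * (1 + 2 * cosh x)\<^sup>2 - 2 * (cosh x + 2) * (2 * (1 + 2 * cosh x) * (2 * sinh x)))
        / ((1 + 2 * cosh x)\<^sup>2 * (1 + 2 * cosh x)\<^sup>2)) (at x)"
    using neq[of x] by (intro DERIV_divide) (auto intro!: derivative_eq_intros)
  \<comment> \<open>Cancelling the common factor \<open>1 + 2 * cosh x\<close> leaves a form whose
    sign is visible.\<close>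
  also have "(2 * sinh x * (1 + 2 * cosh x)\<^sup>2 - 2 * (cosh x + 2) * (2 * (1 + 2 * cosh x) * (2 * sinh x)))
        / ((1 + 2 * cosh x)\<^sup>2 * (1 + 2 * cosh x)\<^sup>2)
      = - (2 * sinh x * (2 * cosh x + 7)) / (1 + 2 * cosh x) ^ 3"
    using neq[of x] by (subst frac_eq_eq) (simp, simp, algebra)
  finally show "((\<lambda>x. 2 * (cosh x + 2) / (1 + 2 * cosh x)\<^sup>2) has_real_derivative
      - (2 * sinh x * (2 * cosh x + 7)) / (1 + 2 * cosh x) ^ 3) (at x)" .
  show "- (2 * sinh x * (2 * cosh x + 7)) / (1 + 2 * cosh x) ^ 3 < 0"
    using x pos[of x] by (intro divide_neg_pos) (auto intro!: mult_pos_pos add_pos_pos)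
qed

section \<open>Log-concavity and log-convexity of each mean\<close>

lemma stolarsky_mean_log_concave_convex:
  fixes m c :: real
  assumes "c \<noteq> 0"
  shows "strictly_bivariate_log_concave_on ({0..} \<times> {0..})
      (\<lambda>(p, q). stolarsky_mean p q (exp (m + c)) (exp (m - c))) \<and>
    strictly_bivariate_log_convex_on ({..0} \<times> {..0})
      (\<lambda>(p, q). stolarsky_mean p q (exp (m + c)) (exp (m - c)))"
proof (rule strictly_bivariate_log_concave_convex_even
    [OF _ _ strictly_concave_deriv_ln_sinhc _ _ assms stolarsky_mean_exp[OF assms]])
  show deriv: "((\<lambda>x. ln (sinhc x)) has_real_derivative cosh x / sinh x - 1 / x) (at x)" if "x > 0" for x
  proof (rule has_field_derivative_transform_within_open[where S = "{0<..}"])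
    show "((\<lambda>x. ln (sinh x) - ln x) has_real_derivative cosh x / sinh x - 1 / x) (at x)"
      using that by (auto intro!: derivative_eq_intros)
  qed (use that in \<open>simp_all add: sinhc_def ln_div\<close>)
  have "((\<lambda>x::real. ln (sinh x / x)) \<longlongrightarrow> 0) (at_right 0)"
    by real_asymp
  then have "((\<lambda>x. ln (sinhc x)) \<longlongrightarrow> 0) (at_right 0)"
    by (rule Lim_transform_eventually) (auto simp: eventually_at_filter sinhc_def)
  then show "continuous_on {0..} (\<lambda>x. ln (sinhc x))"
    by (intro continuous_on_nonneg_realI[OF _ deriv]) (simp_all add: sinhc_def)
qed (simp_all add: sinhc_def)

lemma gini_mean_log_concave_convex:
  fixes m c :: real
  assumes "c \<noteq> 0"
  shows "strictly_bivariate_log_concave_on ({0..} \<times> {0..})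
      (\<lambda>(p, q). gini_mean p q (exp (m + c)) (exp (m - c))) \<and>
    strictly_bivariate_log_convex_on ({..0} \<times> {..0})
      (\<lambda>(p, q). gini_mean p q (exp (m + c)) (exp (m - c)))"
proof (rule strictly_bivariate_log_concave_convex_even
    [OF _ _ strictly_concave_tanh _ _ assms gini_mean_exp[OF assms]])
  show deriv: "((\<lambda>x. ln (cosh x)) has_real_derivative tanh x) (at x)" for x :: real
    by (auto intro!: derivative_eq_intros simp: tanh_def)
  show "continuous_on {0..} (\<lambda>x::real. ln (cosh x))"
    by (intro continuous_at_imp_continuous_on ballI DERIV_isCont[OF deriv])
qed simp_all

lemma identric_mean2_log_concave_convex:
  fixes m c :: real
  assumes "c \<noteq> 0"
  shows "strictly_bivariate_log_concave_on ({0..} \<times> {0..})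
      (\<lambda>(p, q). identric_mean2 p q (exp (m + c)) (exp (m - c))) \<and>
    strictly_bivariate_log_convex_on ({..0} \<times> {..0})
      (\<lambda>(p, q). identric_mean2 p q (exp (m + c)) (exp (m - c)))"
proof (rule strictly_bivariate_log_concave_convex_even
    [OF _ _ strictly_concave_deriv_x_coth _ _ assms identric_mean2_exp[OF assms]])
  let ?F = "\<lambda>x::real. if x = 0 then 0 else x * cosh x / sinh x - 1"
  show deriv: "(?F has_real_derivative cosh x / sinh x - x / (sinh x)\<^sup>2) (at x)" if "x > 0" for x
  proof (rule has_field_derivative_transform_within_open[where S = "{0<..}"])
    have "((\<lambda>x. x * cosh x / sinh x - 1) has_real_derivative
        ((cosh x + x * sinh x) * sinh x - x * cosh x * cosh x) / (sinh x * sinh x)) (at x)"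
      using that by (auto intro!: derivative_eq_intros)
    also have "(cosh x + x * sinh x) * sinh x - x * cosh x * cosh x = cosh x * sinh x - x"
      using hyperbolic_pythagoras[of x] by algebra
    finally show "((\<lambda>x. x * cosh x / sinh x - 1) has_real_derivative
        cosh x / sinh x - x / (sinh x)\<^sup>2) (at x)"
      using that by (simp add: diff_divide_distrib power2_eq_square)
  qed (use that in simp_all)
  \<comment> \<open>Writing x coth x as \<open>cosh x / (sinh x / x)\<close> gives a quotient whose
    numerator and denominator both tend to 1.\<close>
  have "((\<lambda>x::real. cosh x / (sinh x / x) - 1) \<longlongrightarrow> 0) (at_right 0)"
  proof -
    have "((\<lambda>x::real. sinh x / x) \<longlongrightarrow> 1) (at_right 0)"
      by real_asymp
    moreover have "(cosh \<longlongrightarrow> (1::real)) (at_right 0)"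
      by real_asymp
    ultimately have "((\<lambda>x::real. cosh x / (sinh x / x) - 1) \<longlongrightarrow> 1 / 1 - 1) (at_right 0)"
      by (intro tendsto_diff tendsto_divide tendsto_const) simp_all
    then show ?thesis
      by simp
  qed
  then have "(?F \<longlongrightarrow> 0) (at_right 0)"
    by (rule Lim_transform_eventually) (auto simp: eventually_at_filter)
  then show "continuous_on {0..} ?F"
    by (intro continuous_on_nonneg_realI[OF _ deriv]) simp_all
qed simp_all

lemma heronian_mean2_log_concave_convex:
  fixes m c :: real
  assumes "c \<noteq> 0"
  shows "strictly_bivariate_log_concave_on ({0..} \<times> {0..})
      (\<lambda>(p, q). heronian_mean2 p q (exp (m + c)) (exp (m - c))) \<and>
    strictly_bivariate_log_convex_on ({..0} \<times> {..0})
      (\<lambda>(p, q). heronian_mean2 p q (exp (m + c)) (exp (m - c)))"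
proof (rule strictly_bivariate_log_concave_convex_even
    [OF _ _ strictly_concave_deriv_ln_one_plus_two_cosh _ _ assms heronian_mean2_exp[OF assms]])
  have pos: "1 + 2 * cosh x > 0" for x :: real
    by (simp add: add_pos_pos)
  show deriv: "((\<lambda>x. ln (1 + 2 * cosh x)) has_real_derivative 2 * sinh x / (1 + 2 * cosh x)) (at x)" for x :: real
    using pos[of x] by (auto intro!: derivative_eq_intros)
  show "continuous_on {0..} (\<lambda>x::real. ln (1 + 2 * cosh x))"
    by (intro continuous_at_imp_continuous_on ballI DERIV_isCont[OF deriv])
qed simp_all

theorem corollary3p1:
  fixes a b :: real
  assumes "0 < a" and "0 < b" and "a \<noteq> b"
  shows
    "strictly_bivariate_log_concave_on ({0..} \<times> {0..}) (\<lambda>(p, q). stolarsky_mean p q a b) \<and>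
     strictly_bivariate_log_convex_on ({..0} \<times> {..0}) (\<lambda>(p, q). stolarsky_mean p q a b) \<and>
     strictly_bivariate_log_concave_on ({0..} \<times> {0..}) (\<lambda>(p, q). gini_mean p q a b) \<and>
     strictly_bivariate_log_convex_on ({..0} \<times> {..0}) (\<lambda>(p, q). gini_mean p q a b) \<and>
     strictly_bivariate_log_concave_on ({0..} \<times> {0..}) (\<lambda>(p, q). identric_mean2 p q a b) \<and>
     strictly_bivariate_log_convex_on ({..0} \<times> {..0}) (\<lambda>(p, q). identric_mean2 p q a b) \<and>
     strictly_bivariate_log_concave_on ({0..} \<times> {0..}) (\<lambda>(p, q). heronian_mean2 p q a b) \<and>
     strictly_bivariate_log_convex_on ({..0} \<times> {..0}) (\<lambda>(p, q). heronian_mean2 p q a b)"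
proof -
  \<comment> \<open>\<open>exp m\<close> is the geometric mean of \<open>a\<close> and
    \<open>b\<close>; \<open>c\<close> is nonzero as \<open>a\<close> and \<open>b\<close> differ,
    and it may have either sign.\<close>
  define m c where "m = (ln a + ln b) / 2" and "c = (ln a - ln b) / 2"
  have a: "a = exp (m + c)" and b: "b = exp (m - c)"
    using assms by (simp_all add: m_def c_def flip: add_divide_distrib diff_divide_distrib)
  have "c \<noteq> 0"
    using assms by (simp add: c_def)
  then show ?thesis
    unfolding a b
    using stolarsky_mean_log_concave_convex gini_mean_log_concave_convex
      identric_mean2_log_concave_convex heronian_mean2_log_concave_convex
    by blast
qed

end
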